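(* For $c_{t,\delta}=c^\ast+\frac{D}{M^{3/2}}\,\delta\,t^{-1/2}$, $0\le\delta<K$, where $K$ is a positive constant, we have $$u^{[\mathcal{M}]}_{\alpha,t}(c_{t,\delta})=\frac{D}{M^{3/2}}\,x_\alpha(\delta)\sqrt t\,\big(1+o(1)\big),\qquad t\to\infty,$$ where $x_\alpha(\delta)$ is a solution $x$ to the equation $$1-\Phi(\delta+x)+\Phi(\delta-x)\exp\{-2\delta x\}=\alpha.$$
   Context: $M>0$ and $D>0$ are fixed constants (in the underlying renewal model with inter-renewal time $T$ and jump size $Y$, $M=\mathsf{E}T/\mathsf{E}Y$ and $D^2=((\mathsf{E}T)^2\,\mathsf{D}Y+(\mathsf{E}Y)^2\,\mathsf{D}T)/(\mathsf{E}Y)^3$, $\mathsf{D}$ denoting variance), $c^\ast=M^{-1}$, and $\alpha$ is fixed, positive and reasonably small (e.g. $\alpha=0.05$). For $u,t,c>0$, $$\mathcal{M}_{u,c}(t)=\int_0^{ct/u}\frac{1}{x+1}\,\varphi_{\left(cM(x+1),\,\frac{c^2D^2}{u}(x+1)\right)}(x)\,dx,$$ where $\varphi_{(a,b^2)}(x)$ is the density at $x$ of the normal distribution with mean $a$ and variance $b^2$. The heuristic fixed-probability level $u^{[\mathcal{M}]}_{\alpha,t}(c)$ is a positive solution, with respect to $u$, of the equation $\mathcal{M}_{u,c}(t)=\alpha$. $\Phi$ is the standard normal c.d.f.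
   Formalization: The level is taken to be a solution above some constant U independent of t and δ (such solutions are shown to exist for large t), since the equation also has a positive root that stays bounded as t → ∞ and for which the asymptotic formula fails. *)

theory Defs
  imports "HOL-Probability.Probability"
begin

definition Phi :: "real \<Rightarrow> real" where
  "Phi x = cdf std_normal_distribution x"

(* normal_density takes the standard deviation, hence the square root of the variance. *)
definition heur_prob :: "real \<Rightarrow> real \<Rightarrow> real \<Rightarrow> real \<Rightarrow> real \<Rightarrow> real" where
  "heur_prob M D u c t =
     integral {0..c * t / u}
       (\<lambda>x. 1 / (x + 1) *
            normal_density (c * M * (x + 1)) (sqrt (c\<^sup>2 * D\<^sup>2 / u * (x + 1))) x)"

(* A predicate, since the level is "a" positive solution u, which is not unique: heur_prob tends
   to 0 both as u \<rightarrow> 0 and as u \<rightarrow> \<infinity>. For c near 1 / M, besides the solution of order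
   sqrt t there is one that stays bounded as t \<rightarrow> \<infinity>. *)
definition is_heur_level :: "real \<Rightarrow> real \<Rightarrow> real \<Rightarrow> real \<Rightarrow> real \<Rightarrow> real \<Rightarrow> bool" where
  "is_heur_level M D \<alpha> t c u \<longleftrightarrow> u > 0 \<and> heur_prob M D u c t = \<alpha>"

definition c_near :: "real \<Rightarrow> real \<Rightarrow> real \<Rightarrow> real \<Rightarrow> real" where
  "c_near M D t \<delta> = 1 / M + D / M powr (3/2) * \<delta> * t powr (-1/2)"

definition solves_x_eq :: "real \<Rightarrow> real \<Rightarrow> real \<Rightarrow> bool" where
  "solves_x_eq \<alpha> \<delta> x \<longleftrightarrow>
     1 - Phi (\<delta> + x) + Phi (\<delta> - x) * exp (-2 * \<delta> * x) = \<alpha>"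

end

theory Submission
  imports Defs "HOL-Real_Asymp.Real_Asymp"
begin

text \<open>The integral defining \<^const>\<open>heur_prob\<close> has a closed form. Let \<open>F a b\<close> be the left-hand side of
  the limit equation, at \<open>\<delta> = a\<close> and \<open>x = b\<close>. With \<open>\<kappa> = c M - 1\<close>, \<open>l = u / (c D)\<^sup>2\<close> and
  \<open>Y = 1 + c t / u\<close>, the heuristic probability is exactly
  \<open>F (\<kappa> sqrt (l Y)) (sqrt (l / Y)) - F (\<kappa> sqrt l) (sqrt l)\<close>. At \<open>c = c_near M D t \<delta>\<close> and
  \<open>u = D / M powr (3/2) * w * sqrt t\<close> the first term is close to \<open>F \<delta> w\<close>, while the second is
  small unless \<open>u\<close> is bounded. A solution above a suitable cutoff \<open>U\<close> makes the first term at least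
  \<open>\<alpha>\<close> and at most \<open>(1 + \<alpha>) / 2\<close>, which confines \<open>w\<close> to a compact subset of the positive reals.
  There the second term vanishes uniformly, and as \<open>\<partial>F / \<partial>b\<close> is bounded away from 0 and
  \<open>F\<close> is Lipschitz in \<open>a\<close>, \<open>w\<close> is uniformly close to the root of \<open>F \<delta> x = \<alpha>\<close>.\<close>

section \<open>The standard normal distribution function\<close>

text \<open>Differences of \<open>Phi\<close> are integrals of the density, so the fundamental
  theorem of calculus on a bounded window suffices. The inner function \<open>g\<close> lets
  \<open>derivative_intros\<close> treat composites.\<close>

lemma Phi_has_field_derivative [derivative_intros]:
  assumes "(g has_field_derivative g') (at x within S)"
  shows "((\<lambda>x. Phi (g x)) has_field_derivative std_normal_density (g x) * g') (at x within S)"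
proof -
  interpret real_distribution std_normal_distribution
    by (rule real_dist_normal_dist)
  have Phi_diff: "Phi b - Phi a = integral {a..b} std_normal_density" if "a \<le> b" for a b
  proof (cases "a = b")
    case False
    with that have ab: "a < b" by simp
    have si: "set_integrable lborel A std_normal_density" if "A \<in> sets lborel" for A
      unfolding set_integrable_def
      using integrable_mult_indicator[OF that, of std_normal_density] integrable_normal_moment[of 1 0 0]
      by simp
    have "Phi b - Phi a = measure std_normal_distribution {a<..b}"
      unfolding Phi_def by (rule cdf_diff_eq[OF ab])
    also have "\<dots> = (LINT x:{a<..b}|lborel. std_normal_density x)"
      unfolding measure_def set_lebesgue_integral_def
      by (subst emeasure_density; simp add: integral_eq_nn_integral mult.commute 
            ennreal_mult ennreal_indicator)
    also have "\<dots> = integral {a<..b} std_normal_density"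
      by (rule set_borel_integral_eq_integral(2)[OF si]) simp
    also have "\<dots> = integral {a..b} std_normal_density"
      by (rule integral_spike_set; rule negligible_subset[of "{a}"]) auto
    finally show ?thesis .
  qed simp
  have cont: "continuous_on T std_normal_density" for T
    unfolding std_normal_density_def by (intro continuous_intros) auto
  have "(Phi has_field_derivative std_normal_density y) (at y)" for y
  proof -
    have "((\<lambda>z. integral {y - 1..z} std_normal_density) has_real_derivative std_normal_density y)
        (at y within {y - 1..y + 1})"
      by (rule integral_has_real_derivative) (auto intro: cont)
    then have "((\<lambda>z. integral {y - 1..z} std_normal_density) has_real_derivative std_normal_density y) (at y)"
      by (simp add: at_within_Icc_at)
    then have "((\<lambda>z. integral {y - 1..z} std_normal_density + Phi (y - 1)) has_real_derivative
        std_normal_density y) (at y)"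
      by (auto intro!: derivative_eq_intros)
    moreover have "\<forall>\<^sub>F z in nhds y. integral {y - 1..z} std_normal_density + Phi (y - 1) = Phi z"
      using eventually_nhds_in_open[of "{y - 1<..}" y]
      by (auto elim!: eventually_mono simp: Phi_diff[symmetric])
    ultimately show ?thesis
      by (subst (asm) DERIV_cong_ev[OF refl _ refl])
  qed
  from DERIV_chain2[OF this assms] show ?thesis .
qed

lemma Phi_nonneg: "0 \<le> Phi x" and Phi_le_1: "Phi x \<le> 1"
proof -
  interpret real_distribution std_normal_distribution
    by (rule real_dist_normal_dist)
  show "0 \<le> Phi x" "Phi x \<le> 1"
    unfolding Phi_def by (simp_all add: cdf_nonneg cdf_bounded_prob)
qed

lemma Phi_tendsto_at_top: "(Phi \<longlongrightarrow> 1) at_top" and Phi_tendsto_at_bot: "(Phi \<longlongrightarrow> 0) at_bot"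
proof -
  interpret real_distribution std_normal_distribution
    by (rule real_dist_normal_dist)
  show "(Phi \<longlongrightarrow> 1) at_top" "(Phi \<longlongrightarrow> 0) at_bot"
    unfolding Phi_def[abs_def] by (rule cdf_lim_at_top_prob cdf_lim_at_bot)+
qed

lemma continuous_on_Phi [continuous_intros]:
  assumes "continuous_on S f"
  shows "continuous_on S (\<lambda>x. Phi (f x))"
proof -
  have "continuous_on UNIV Phi"
    using Phi_has_field_derivative[OF DERIV_ident]
    by (intro DERIV_continuous_on) auto
  from continuous_on_compose2[OF this assms] show ?thesis by simp
qed

section \<open>Crossing probability: monotonicity and slope bounds\<close>

text \<open>The probability that a Brownian motion with drift \<open>- a\<close> exceeds the level \<open>b\<close> before time 1.\<close>

definition bm_cross :: "real \<Rightarrow> real \<Rightarrow> real" where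
  "bm_cross a b = 1 - Phi (a + b) + Phi (a - b) * exp (- 2 * a * b)"

lemma solves_x_eq_iff: "solves_x_eq \<alpha> \<delta> x \<longleftrightarrow> bm_cross \<delta> x = \<alpha>"
  by (simp add: solves_x_eq_def bm_cross_def)

lemma continuous_on_bm_cross [continuous_intros]:
  assumes "continuous_on S f" "continuous_on S g"
  shows "continuous_on S (\<lambda>x. bm_cross (f x) (g x))"
  unfolding bm_cross_def using assms by (intro continuous_intros)

text \<open>Rests on (a - b)^2 + 4 a b = (a + b)^2. The density terms coming from the two
  \<open>Phi\<close> summands thus cancel under differentiation in \<open>a\<close> and double under
  differentiation in \<open>b\<close>.\<close>

lemma std_normal_density_reflect:
  "std_normal_density (a - b) * exp (- 2 * a * b) = std_normal_density (a + b)"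
proof -
  have "- ((a - b)\<^sup>2 / 2) + - 2 * a * b = - ((a + b)\<^sup>2 / 2)"
    by (simp add: power2_eq_square algebra_simps)
  then show ?thesis
    by (simp add: std_normal_density_def flip: exp_add)
qed

lemma bm_cross_has_derivative_right:
  "(bm_cross a has_real_derivative
     - 2 * std_normal_density (a + b) - 2 * a * Phi (a - b) * exp (- 2 * a * b)) (at b)"
proof -
  have "(bm_cross a has_real_derivative
      0 - std_normal_density (a + b) * (0 + 1)
        + (std_normal_density (a - b) * (0 - 1) * exp (- 2 * a * b)
          + exp (- 2 * a * b) * (- 2 * a * 1) * Phi (a - b))) (at b)"
    unfolding bm_cross_def[abs_def]
    by (intro derivative_intros DERIV_cmult)
  then show ?thesis
    by (rule DERIV_cong) (unfold std_normal_density_reflect[of a b, symmetric], simp add: algebra_simps)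
qed

lemma bm_cross_has_derivative_left:
  "((\<lambda>a. bm_cross a b) has_real_derivative - 2 * b * Phi (a - b) * exp (- 2 * a * b)) (at a)"
proof -
  have "((\<lambda>a. bm_cross a b) has_real_derivative
      0 - std_normal_density (a + b) * (1 + 0)
        + (std_normal_density (a - b) * (1 - 0) * exp (- 2 * a * b)
          + exp (- 2 * a * b) * (- 2 * 1 * b) * Phi (a - b))) (at a)"
    unfolding bm_cross_def[abs_def]
    by (intro derivative_intros DERIV_cmult DERIV_cmult_right)
  then show ?thesis
    by (rule DERIV_cong) (unfold std_normal_density_reflect[of a b, symmetric], simp add: algebra_simps)
qed

lemma bm_cross_nonneg: "0 \<le> bm_cross a b"
  using Phi_le_1[of "a + b"] Phi_nonneg[of "a - b"] by (simp add: bm_cross_def)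

lemma bm_cross_0_right [simp]: "bm_cross a 0 = 1"
  by (simp add: bm_cross_def)

text \<open>For nonnegative drift both terms of the derivative are nonpositive, and the density term
  is strictly negative.\<close>

lemma bm_cross_less_iff:
  assumes "0 \<le> a"
  shows "bm_cross a b < bm_cross a b' \<longleftrightarrow> b' < b"
proof -
  have "bm_cross a y < bm_cross a x" if "x < y" for x y
  proof (rule DERIV_neg_imp_decreasing[OF that])
    fix z
    have "0 < std_normal_density (a + z)" "0 \<le> a * Phi (a - z) * exp (- 2 * a * z)"
      using assms by (auto simp: Phi_nonneg normal_density_pos)
    then show "\<exists>y. (bm_cross a has_real_derivative y) (at z) \<and> y < 0"
      using bm_cross_has_derivative_right[of a z] by (intro exI conjI) (assumption, simp)
  qed
  then show ?thesis
    by (metis linorder_neqE_linordered_idom order_less_asym order_less_irrefl)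
qed

lemma bm_cross_le_iff: "0 \<le> a \<Longrightarrow> bm_cross a b \<le> bm_cross a b' \<longleftrightarrow> b' \<le> b"
  using bm_cross_less_iff[of a b' b] by (simp flip: not_less)

text \<open>Serves to trade a varying drift for one of the extremes \<open>0\<close>,
  \<open>K\<close> and \<open>K + 1\<close>.\<close>

lemma bm_cross_antimono_left:
  assumes "a \<le> a'" "0 \<le> b"
  shows "bm_cross a' b \<le> bm_cross a b"
proof (rule DERIV_nonpos_imp_nonincreasing[OF assms(1)])
  fix z
  show "\<exists>y. ((\<lambda>a. bm_cross a b) has_real_derivative y) (at z) \<and> y \<le> 0"
    using bm_cross_has_derivative_left[of b z] assms
    by (intro exI conjI) (assumption, simp add: Phi_nonneg)
qed

lemma bm_cross_Lipschitz_left: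
  assumes "0 \<le> a" "0 \<le> a'" "0 \<le> b"
  shows "\<bar>bm_cross a b - bm_cross a' b\<bar> \<le> 2 * b * \<bar>a - a'\<bar>"
proof -
  have "norm (bm_cross a b - bm_cross a' b) \<le> 2 * b * norm (a - a')"
  proof (rule field_differentiable_bound[of "{0..}"])
    fix z :: real assume z: "z \<in> {0..}"
    show "((\<lambda>a. bm_cross a b) has_real_derivative
        - 2 * b * Phi (z - b) * exp (- 2 * z * b)) (at z within {0..})"
      by (rule has_field_derivative_at_within[OF bm_cross_has_derivative_left])
    have "Phi (z - b) * exp (- 2 * z * b) \<le> 1 * 1"
      using z assms by (intro mult_mono) (auto simp: Phi_le_1)
    then have "b * (Phi (z - b) * exp (- 2 * z * b)) \<le> b * 1"
      using assms by (intro mult_left_mono) auto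
    then show "norm (- 2 * b * Phi (z - b) * exp (- 2 * z * b)) \<le> 2 * b"
      using assms by (simp add: abs_mult Phi_nonneg)
  qed (use assms in auto)
  then show ?thesis by simp
qed

text \<open>Mean value theorem: the drift part of the derivative only steepens the descent, and the
  density part is smallest at the corner \<open>A + B\<close>. An error in value thereby becomes an
  error in the level.\<close>

lemma bm_cross_expansion_right:
  assumes "0 \<le> a" "a \<le> A" "b \<in> {0..B}" "b' \<in> {0..B}"
  shows "2 * std_normal_density (A + B) * \<bar>b - b'\<bar> \<le> \<bar>bm_cross a b - bm_cross a b'\<bar>"
proof -
  have main: "2 * std_normal_density (A + B) * (y - x) \<le> bm_cross a x - bm_cross a y"
    if xy: "x < y" "0 \<le> x" "y \<le> B" for x y
  proof -
    obtain z where z: "x < z" "z < y" and eq: "bm_cross a y - bm_cross a x =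
        (y - x) * (- 2 * std_normal_density (a + z) - 2 * a * Phi (a - z) * exp (- 2 * a * z))"
      using MVT2[OF xy(1) bm_cross_has_derivative_right] by blast
    have "(a + z)\<^sup>2 \<le> (A + B)\<^sup>2"
      using z xy assms by (intro power_mono) auto
    then have "std_normal_density (A + B) \<le> std_normal_density (a + z)"
      by (auto simp: std_normal_density_def intro!: divide_right_mono mult_left_mono)
    moreover have "0 \<le> a * Phi (a - z) * exp (- 2 * a * z)"
      using assms by (auto simp: Phi_nonneg)
    ultimately have "2 * std_normal_density (A + B) \<le>
        2 * std_normal_density (a + z) + 2 * a * Phi (a - z) * exp (- 2 * a * z)" by simp
    from mult_left_mono[OF this, of "y - x"] show ?thesis
      using eq xy by (simp add: algebra_simps)
  qed
  consider "b < b'" | "b = b'" | "b' < b" by linarith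
  then show ?thesis
    using main[of b b'] main[of b' b] assms by cases auto
qed

lemma bm_cross_0_tendsto: "(bm_cross 0 \<longlongrightarrow> 0) at_top"
proof -
  have "((\<lambda>b. 1 - Phi b + Phi (- b)) \<longlongrightarrow> 1 - 1 + 0) at_top"
    by (intro tendsto_intros Phi_tendsto_at_top
          filterlim_compose[OF Phi_tendsto_at_bot filterlim_uminus_at_bot_at_top])
  then show ?thesis by (simp add: bm_cross_def[abs_def])
qed

text \<open>Intermediate values between 1 at level 0 and a value below \<open>p\<close> far out,
  where the driftless case dominates.\<close>

lemma bm_cross_solution_exists:
  assumes "0 \<le> a" "0 < p" "p < 1"
  obtains x where "0 < x" "bm_cross a x = p"
proof -
  from order_tendstoD(2)[OF bm_cross_0_tendsto assms(2)] obtain N where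
    N: "\<And>y. y \<ge> N \<Longrightarrow> bm_cross 0 y < p"
    by (auto simp: eventually_at_top_linorder)
  define y where "y = max N 0"
  have "bm_cross a y \<le> bm_cross 0 y"
    by (rule bm_cross_antimono_left) (use assms in \<open>auto simp: y_def\<close>)
  then have "bm_cross a y \<le> p" using N[of y] by (simp add: y_def)
  moreover have "continuous_on {0..y} (\<lambda>x. bm_cross a x)"
    by (intro continuous_intros)
  ultimately obtain x where x: "0 \<le> x" "bm_cross a x = p"
    using IVT2'[of "bm_cross a" y p 0] assms by (auto simp: y_def)
  with assms(3) have "x \<noteq> 0" by auto
  with x show thesis by (intro that[of x]) auto
qed

section \<open>Closed form of the heuristic probability\<close>

text \<open>In the variable \<open>y = x + 1\<close> the integrand is an inverse Gaussian density (defective if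
  \<open>c * M > 1\<close>) with parameters \<open>1 / (1 - c * M)\<close> and \<open>l\<close>, which has an elementary primitive in
  terms of \<^const>\<open>Phi\<close>.\<close>

lemma heur_prob_eq_bm_cross:
  fixes M D u c t :: real
  assumes "0 < D" "0 < u" "0 < c" "0 < t"
  defines "\<kappa> \<equiv> c * M - 1" and "l \<equiv> u / (c\<^sup>2 * D\<^sup>2)" and "Y \<equiv> 1 + c * t / u"
  shows "heur_prob M D u c t =
    bm_cross (\<kappa> * sqrt (l * Y)) (sqrt (l / Y)) - bm_cross (\<kappa> * sqrt l) (sqrt l)"
proof -
  have l: "0 < l" using assms by (simp add: l_def)
  \<comment> \<open>The first term of the closed form with \<open>Y\<close> replaced by
    \<open>x + 1\<close>; at \<open>x = 0\<close> it becomes the subtracted term.\<close>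
  define G where "G x = bm_cross (\<kappa> * (sqrt l * sqrt (x + 1))) (sqrt l / sqrt (x + 1))" for x
  have "((\<lambda>x. 1 / (x + 1) * normal_density (c * M * (x + 1)) (sqrt (c\<^sup>2 * D\<^sup>2 / u * (x + 1))) x)
      has_integral G (c * t / u) - G 0) {0..c * t / u}"
  proof (rule fundamental_theorem_of_calculus)
    show "0 \<le> c * t / u" using assms by simp
    fix x assume "x \<in> {0..c * t / u}"
    then have x: "0 < x + 1" by simp
    define s where "s = sqrt (x + 1)"
    define r where "r = sqrt l"
    have s: "0 < s" "x = s\<^sup>2 - 1" using x by (simp_all add: s_def)
    have r: "0 < r" using l by (simp_all add: r_def)
    \<comment> \<open>The product of the two arguments of \<open>bm_cross\<close> is \<kappa> r^2,
      free of x, so the exponential factor is constant.\<close>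
    define E where "E = exp (- (2 * \<kappa> * r\<^sup>2))"
    have G_eq: "G y = 1 - Phi (\<kappa> * (r * sqrt (y + 1)) + r / sqrt (y + 1)) +
        Phi (\<kappa> * (r * sqrt (y + 1)) - r / sqrt (y + 1)) * E" if "y > - 1" for y
      using that by (simp add: G_def bm_cross_def E_def r_def[symmetric] power2_eq_square mult_ac)
    have reflect: "std_normal_density (\<kappa> * (r * s) - r / s) * E = std_normal_density (\<kappa> * (r * s) + r / s)"
      using std_normal_density_reflect[of "\<kappa> * (r * s)" "r / s"] s
      by (simp add: E_def power2_eq_square mult_ac)
    have sd: "sqrt (c\<^sup>2 * D\<^sup>2 / u * (x + 1)) = s / r"
      using assms by (simp add: s_def r_def l_def real_sqrt_mult real_sqrt_divide)
    have sq: "(x - c * M * (x + 1))\<^sup>2 / (s / r)\<^sup>2 = (\<kappa> * (r * s) + r / s)\<^sup>2"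
    proof -
      have "x - c * M * (x + 1) = - (\<kappa> * s\<^sup>2 + 1)"
        by (simp add: \<kappa>_def s(2) algebra_simps)
      moreover have "\<kappa> * (r * s) + r / s = (\<kappa> * s\<^sup>2 + 1) / (s / r)"
        using s(1) r by (simp add: power2_eq_square field_simps)
      ultimately show ?thesis by (simp only: power_divide power2_minus)
    qed
    have dens: "normal_density (c * M * (x + 1)) (s / r) x = r / s * std_normal_density (\<kappa> * (r * s) + r / s)"
      using s(1) r sq[symmetric]
      by (simp add: normal_density_def real_sqrt_mult mult_ac)
    have sqrt_deriv: "((\<lambda>y. sqrt (y + 1)) has_real_derivative 1 / (2 * s)) (at x)"
      using x by (auto intro!: derivative_eq_intros simp: s_def field_simps)
    have inv_deriv: "((\<lambda>y. r / sqrt (y + 1)) has_real_derivative - r / (2 * s ^ 3)) (at x)"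
      by (rule DERIV_cong[OF DERIV_divide[OF DERIV_const sqrt_deriv]])
        (use s(1) in \<open>simp_all add: s_def[symmetric] power3_eq_cube\<close>)
    have "((\<lambda>y. 1 - Phi (\<kappa> * (r * sqrt (y + 1)) + r / sqrt (y + 1)) +
        Phi (\<kappa> * (r * sqrt (y + 1)) - r / sqrt (y + 1)) * E) has_real_derivative
        0 - std_normal_density (\<kappa> * (r * sqrt (x + 1)) + r / sqrt (x + 1))
             * (\<kappa> * (r * (1 / (2 * s))) + - r / (2 * s ^ 3))
        + std_normal_density (\<kappa> * (r * sqrt (x + 1)) - r / sqrt (x + 1))
             * (\<kappa> * (r * (1 / (2 * s))) - - r / (2 * s ^ 3)) * E) (at x)"
      by (intro derivative_intros DERIV_cmult DERIV_cmult_right sqrt_deriv inv_deriv)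
    \<comment> \<open>Once reflection equates the densities, the \<kappa> terms cancel and the two r
      / (2 s^3) terms add up.\<close>
    also have "0 - std_normal_density (\<kappa> * (r * sqrt (x + 1)) + r / sqrt (x + 1))
             * (\<kappa> * (r * (1 / (2 * s))) + - r / (2 * s ^ 3))
        + std_normal_density (\<kappa> * (r * sqrt (x + 1)) - r / sqrt (x + 1))
             * (\<kappa> * (r * (1 / (2 * s))) - - r / (2 * s ^ 3)) * E
        = std_normal_density (\<kappa> * (r * s) + r / s) * (r / s ^ 3)"
      unfolding s_def[symmetric] reflect[symmetric] using s(1)
      by (simp add: field_simps)
    also have "\<dots> = 1 / (x + 1) * (r / s * std_normal_density (\<kappa> * (r * s) + r / s))"
      using s by (simp add: power3_eq_cube power2_eq_square)
    finally have "(G has_real_derivative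
        1 / (x + 1) * (r / s * std_normal_density (\<kappa> * (r * s) + r / s))) (at x)"
      by (rule has_field_derivative_transform_within_open[of _ _ _ "{- 1<..}"])
        (use x in \<open>auto simp: G_eq\<close>)
    then show "(G has_vector_derivative
        1 / (x + 1) * normal_density (c * M * (x + 1)) (sqrt (c\<^sup>2 * D\<^sup>2 / u * (x + 1))) x)
        (at x within {0..c * t / u})"
      unfolding sd dens
      by (simp add: has_real_derivative_iff_has_vector_derivative has_vector_derivative_at_within)
  qed
  then have "heur_prob M D u c t = G (c * t / u) - G 0"
    unfolding heur_prob_def by (rule integral_unique)
  then show ?thesis
    by (simp add: G_def Y_def real_sqrt_mult real_sqrt_divide add.commute)
qed

section \<open>Dimensionless variables\<close>

text \<open>Dimensionless form: \<open>\<rho> = D / sqrt (M * t)\<close> is the small parameter, the level is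
  \<open>u = D / M powr (3/2) * w * sqrt t\<close>, and \<open>c * M = 1 + \<delta> * \<rho>\<close>. As \<open>\<rho>\<close> tends to 0,
  \<open>drift_arg\<close> and \<open>level_arg\<close> tend to \<open>\<delta>\<close> and \<open>w\<close>.\<close>

definition drift_arg :: "real \<Rightarrow> real \<Rightarrow> real \<Rightarrow> real" where
  "drift_arg \<rho> \<delta> w = \<delta> * sqrt (1 + \<delta> * \<rho> + \<rho> * w) / (1 + \<delta> * \<rho>)"

definition level_arg :: "real \<Rightarrow> real \<Rightarrow> real \<Rightarrow> real" where
  "level_arg \<rho> \<delta> w = w / ((1 + \<delta> * \<rho>) * sqrt (1 + \<delta> * \<rho> + \<rho> * w))"

text \<open>This is \<open>sqrt l\<close> of the closed form. For bounded \<delta> and w bounded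
  away from 0 it tends to infinity as \<rho> tends to 0, so the subtracted term vanishes.\<close>

definition tail_arg :: "real \<Rightarrow> real \<Rightarrow> real \<Rightarrow> real" where
  "tail_arg \<rho> \<delta> w = sqrt (w / (\<rho> * (1 + \<delta> * \<rho>)\<^sup>2))"

definition scaled_prob :: "real \<Rightarrow> real \<Rightarrow> real \<Rightarrow> real" where
  "scaled_prob \<rho> \<delta> w = bm_cross (drift_arg \<rho> \<delta> w) (level_arg \<rho> \<delta> w) -
     bm_cross (\<delta> * \<rho> * tail_arg \<rho> \<delta> w) (tail_arg \<rho> \<delta> w)"

text \<open>An exact identity at every t: c M = 1 + \<delta> \<rho> and c t / u = (1 + \<delta>
  \<rho>) / (\<rho> w), so time enters only through \<rho>.\<close>

lemma heur_prob_rescale: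
  assumes "0 < M" "0 < D" "0 < t" "0 \<le> \<delta>" "0 < w"
  defines "\<rho> \<equiv> D / sqrt M * t powr (- 1 / 2)"
  shows "heur_prob M D (D / M powr (3/2) * w * sqrt t) (c_near M D t \<delta>) t = scaled_prob \<rho> \<delta> w"
proof -
  define m where "m = sqrt M"
  define s where "s = sqrt t"
  have m: "0 < m" "M = m\<^sup>2" using assms by (simp_all add: m_def)
  have s: "0 < s" "t = s\<^sup>2" using assms by (simp_all add: s_def)
  have "M powr (3/2) = M powr (1 + 1/2)" by simp
  also have "\<dots> = M * sqrt M" using assms by (simp only: powr_add powr_half_sqrt) simp
  finally have m3: "M powr (3/2) = m ^ 3"
    using assms by (simp add: m_def power3_eq_cube)
  have s1: "t powr (- 1 / 2) = 1 / s"
    using assms by (simp add: s_def powr_minus_divide powr_half_sqrt)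
  have \<rho>: "\<rho> = D / (m * s)" unfolding \<rho>_def s1 m_def by simp
  have \<rho>_pos: "0 < \<rho>" using assms m s by (simp add: \<rho>)
  define k where "k = 1 + \<delta> * \<rho>"
  have k: "1 \<le> k" using assms \<rho>_pos by (simp add: k_def)
  define u where "u = D / M powr (3/2) * w * sqrt t"
  define c where "c = c_near M D t \<delta>"
  define S where "S = sqrt (1 + \<delta> * \<rho> + \<rho> * w)"
  define l where "l = w / (\<rho> * k\<^sup>2)"
  have S2: "S\<^sup>2 = k + \<rho> * w" "0 < S"
    using assms \<rho>_pos by (auto simp: S_def k_def intro!: real_sqrt_pow2 add_nonneg_nonneg add_pos_nonneg)
  have u: "u = D * w * s / m ^ 3" by (simp add: u_def m3 s_def)
  have c: "c = k / m\<^sup>2"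
    using m s unfolding c_def c_near_def s1 m3
    by (simp add: k_def \<rho> power2_eq_square power3_eq_cube field_simps)
  have pos: "0 < u" "0 < c"
    using assms m s k by (simp_all add: u c)
  have cM: "c * M - 1 = \<delta> * \<rho>" using m by (simp add: c k_def)
  have l: "u / (c\<^sup>2 * D\<^sup>2) = l"
    using assms(2) m s k by (simp add: u c l_def \<rho> field_simps power2_eq_square power3_eq_cube)
  have "1 + c * t / u = 1 + k / (\<rho> * w)"
    using assms(2,5) m(1) s(1) by (simp add: u c s(2) \<rho> field_simps power2_eq_square power3_eq_cube)
  also have "\<dots> = S\<^sup>2 / (\<rho> * w)"
    using assms(5) \<rho>_pos by (simp add: S2 field_simps)
  finally have Y: "1 + c * t / u = S\<^sup>2 / (\<rho> * w)" .
  have "l * (S\<^sup>2 / (\<rho> * w)) = (S / (\<rho> * k))\<^sup>2"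
    using assms(5) \<rho>_pos k by (simp add: l_def field_simps power2_eq_square)
  then have lY: "sqrt (l * (S\<^sup>2 / (\<rho> * w))) = S / (\<rho> * k)"
    using S2 \<rho>_pos k by (simp add: real_sqrt_divide)
  have "l / (S\<^sup>2 / (\<rho> * w)) = (w / (k * S))\<^sup>2"
    using assms(5) \<rho>_pos k S2(2) by (simp add: l_def field_simps power2_eq_square)
  then have ldY: "sqrt (l / (S\<^sup>2 / (\<rho> * w))) = w / (k * S)"
    using S2 assms(5) k by (simp add: real_sqrt_divide)
  have "heur_prob M D u c t =
    bm_cross (\<delta> * \<rho> * (S / (\<rho> * k))) (w / (k * S)) - bm_cross (\<delta> * \<rho> * sqrt l) (sqrt l)"
    using heur_prob_eq_bm_cross[OF assms(2) pos assms(3), of M] unfolding cM l Y lY ldY .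
  also have "\<delta> * \<rho> * (S / (\<rho> * k)) = \<delta> * S / k" using \<rho>_pos by simp
  finally show ?thesis
    by (simp add: scaled_prob_def drift_arg_def level_arg_def tail_arg_def u_def c_def S_def k_def l_def)
qed

section \<open>Constants and error bound for small \<rho>\<close>

text \<open>\<open>B\<close> and \<open>b\<^sub>0\<close> will bound \<^const>\<open>level_arg\<close> at a solution from above and below, \<open>x\<^sub>0\<close> bounds
  the limit levels from below, and \<open>v\<close> determines the cutoff that discards the bounded solutions.\<close>

locale scaled_levels =
  fixes \<alpha> K B b\<^sub>0 x\<^sub>0 v :: real
  assumes \<alpha>: "0 < \<alpha>" "\<alpha> < 1" and K: "0 < K"
    and B: "0 < B" "bm_cross 0 B = \<alpha>"
    and b\<^sub>0: "0 < b\<^sub>0" "bm_cross (K + 1) b\<^sub>0 = (1 + \<alpha>) / 2"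
    and x\<^sub>0: "0 < x\<^sub>0" "bm_cross K x\<^sub>0 = \<alpha>"
    and v: "0 < v" "bm_cross 0 v = (1 - \<alpha>) / 2"
begin

definition W :: real where "W = 1 + 12 * B\<^sup>2"
definition L :: real where "L = K + W + 1"
text \<open>The 4 absorbs (1 + \<delta> \<rho>)^2: for admissible \<rho>, w \<ge> V \<rho> forces
  \<open>tail_arg\<close> to be at least \<open>v\<close>.\<close>

definition V :: real where "V = 4 * v\<^sup>2"

text \<open>\<open>K * \<rho> \<le> 1\<close> keeps 1 + \<delta> \<rho> below 2, the bound with
  \<open>L\<close> keeps \<open>drift_arg\<close> below \<open>K + 1\<close>, and the last two place
  the left end of the interval on which a level is sought.\<close>

definition admissible :: "real \<Rightarrow> bool" where
  "admissible \<rho> \<longleftrightarrow> 0 < \<rho> \<and> \<rho> \<le> 1 \<and> K * \<rho> \<le> 1 \<and> K * (\<rho> * L) \<le> 1 \<and>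
     (V + 1) * \<rho> \<le> b\<^sub>0 \<and> (V + 1) * \<rho> \<le> W + 1"

text \<open>A bound for |w - x| over the lower bound \<open>x\<^sub>0\<close> for x. The first
  summand covers w - \<open>level_arg\<close>; the second covers \<open>level_arg\<close> - x, being
  the drift and tail errors in value over the least slope.\<close>

definition err :: "real \<Rightarrow> real" where
  "err \<rho> = (B * ((1 + K * \<rho>) * (1 + \<rho> * L) - 1) +
     (2 * B * (K * (\<rho> * L + K * \<rho>)) + bm_cross 0 (sqrt (b\<^sub>0 / (4 * \<rho>)))) /
       (2 * std_normal_density (K + B))) / x\<^sub>0"

lemma W_pos: "0 < W"
  unfolding W_def by (rule add_pos_nonneg) auto

lemma V_pos: "0 < V" using v by (simp add: V_def)

lemma err_tendsto: "(err \<longlongrightarrow> 0) (at_right 0)"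
proof -
  have "filterlim (\<lambda>\<rho>. sqrt (b\<^sub>0 / (4 * \<rho>))) at_top (at_right 0)"
    using b\<^sub>0(1) by real_asymp
  from filterlim_compose[OF bm_cross_0_tendsto this]
  have *: "((\<lambda>\<rho>. bm_cross 0 (sqrt (b\<^sub>0 / (4 * \<rho>)))) \<longlongrightarrow> 0) (at_right 0)" .
  have "(err \<longlongrightarrow> (B * ((1 + K * 0) * (1 + 0 * L) - 1) +
     (2 * B * (K * (0 * L + K * 0)) + 0) / (2 * std_normal_density (K + B))) / x\<^sub>0) (at_right 0)"
    unfolding err_def[abs_def] using x\<^sub>0 normal_density_pos[of 1 0 "K + B"]
    by (intro tendsto_intros *) auto
  then show ?thesis by simp
qed

lemma eventually_admissible: "\<forall>\<^sub>F \<rho> in at_right 0. admissible \<rho>"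
proof -
  have small: "\<forall>\<^sub>F \<rho> in at_right 0. y * \<rho> \<le> z" if "0 < z" for y z :: real
  proof -
    have "((\<lambda>\<rho>. y * \<rho>) \<longlongrightarrow> y * 0) (at_right 0)" by (intro tendsto_intros)
    from order_tendstoD(2)[OF this, of z] that show ?thesis
      by (auto elim: eventually_mono)
  qed
  have "\<forall>\<^sub>F \<rho> :: real in at_right 0. 0 < \<rho>" by (simp add: eventually_at_right_less)
  moreover have "\<forall>\<^sub>F \<rho> in at_right 0. (K * L) * \<rho> \<le> 1" by (rule small) simp
  moreover have "\<forall>\<^sub>F \<rho> in at_right 0. (V + 1) * \<rho> \<le> W + 1" using W_pos by (intro small) simp
  ultimately show ?thesis
    using small[of 1 1, OF zero_less_one] small[of 1 K, OF zero_less_one]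
      small[OF b\<^sub>0(1), of "V + 1"]
    by eventually_elim (simp add: admissible_def mult_ac)
qed

section \<open>Bounds uniform in \<delta> for an admissible \<rho>\<close>

context
  fixes \<rho> \<delta> :: real
  assumes adm: "admissible \<rho>" and \<delta>: "0 \<le> \<delta>" "\<delta> \<le> K"
begin

lemma \<rho>: "0 < \<rho>" "\<rho> \<le> 1" "K * \<rho> \<le> 1" "K * (\<rho> * L) \<le> 1" "(V + 1) * \<rho> \<le> b\<^sub>0" "(V + 1) * \<rho> \<le> W + 1"
  using adm by (auto simp: admissible_def)

lemma \<delta>\<rho>: "0 \<le> \<delta> * \<rho>" "\<delta> * \<rho> \<le> K * \<rho>" "\<delta> * \<rho> \<le> 1"
proof -
  show "0 \<le> \<delta> * \<rho>" "\<delta> * \<rho> \<le> K * \<rho>"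
    using \<delta> \<rho> by (simp_all add: mult_right_mono)
  then show "\<delta> * \<rho> \<le> 1" using \<rho> by linarith
qed

lemma scale_ge_1: "0 \<le> w \<Longrightarrow> 1 \<le> sqrt (1 + \<delta> * \<rho> + \<rho> * w)"
  using \<delta>\<rho> \<rho> by simp

lemma scale_le:
  assumes "0 \<le> w" "w \<le> W + 1"
  shows "sqrt (1 + \<delta> * \<rho> + \<rho> * w) \<le> 1 + \<rho> * L"
proof -
  have "\<rho> * w \<le> \<rho> * (W + 1)" using \<rho> assms by (intro mult_left_mono) auto
  then have le: "\<delta> * \<rho> + \<rho> * w \<le> \<rho> * L" using \<delta>\<rho> by (simp add: L_def algebra_simps)
  moreover have "0 \<le> \<rho> * L" using \<rho> W_pos K by (simp add: L_def)
  ultimately have "1 + \<delta> * \<rho> + \<rho> * w \<le> (1 + \<rho> * L)\<^sup>2"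
    using zero_le_power2[of "\<rho> * L"] unfolding power2_sum power_one mult_1_right
    by linarith
  then show ?thesis
    using \<open>0 \<le> \<rho> * L\<close> by (intro real_le_lsqrt) auto
qed

lemma level_arg_eq: "0 \<le> w \<Longrightarrow> w = level_arg \<rho> \<delta> w * ((1 + \<delta> * \<rho>) * sqrt (1 + \<delta> * \<rho> + \<rho> * w))"
  using scale_ge_1[of w] \<delta>\<rho> by (simp add: level_arg_def)

lemma level_arg_nonneg: "0 \<le> w \<Longrightarrow> 0 \<le> level_arg \<rho> \<delta> w"
  using scale_ge_1[of w] \<delta>\<rho> by (simp add: level_arg_def)

lemma level_arg_le:
  assumes "0 \<le> w"
  shows "level_arg \<rho> \<delta> w \<le> w"
proof -
  have "1 * 1 \<le> (1 + \<delta> * \<rho>) * sqrt (1 + \<delta> * \<rho> + \<rho> * w)"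
    using scale_ge_1[OF assms] \<delta>\<rho> by (intro mult_mono) auto
  from mult_left_mono[OF this level_arg_nonneg[OF assms]] level_arg_eq[OF assms]
  show ?thesis by simp
qed

text \<open>\<open>level_arg\<close> still grows like the square root of w: for w > 1 the root S
  satisfies S^2 \<le> 3 w, while w \<le> 2 B S, so w^2 \<le> 12 B^2 w. The 1 in \<open>W\<close>
  covers w \<le> 1.\<close>

lemma level_arg_le_imp_bounded:
  assumes "0 \<le> w" "level_arg \<rho> \<delta> w \<le> B"
  shows "w \<le> W"
proof (cases "w \<le> 1")
  case True
  then show ?thesis using zero_le_power2[of B] unfolding W_def by linarith
next
  case False
  define S where "S = sqrt (1 + \<delta> * \<rho> + \<rho> * w)"
  have S: "1 \<le> S" "S\<^sup>2 = 1 + \<delta> * \<rho> + \<rho> * w"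
    using scale_ge_1[OF assms(1)] assms \<delta>\<rho> \<rho> by (simp_all add: S_def)
  have "\<rho> * w \<le> 1 * w" using \<rho> assms by (intro mult_right_mono) auto
  then have S2: "S\<^sup>2 \<le> 3 * w" using False \<delta>\<rho> unfolding S by linarith
  have "w \<le> B * (2 * S)"
    using S \<delta>\<rho> B assms level_arg_nonneg[OF assms(1)] unfolding S_def
    by (subst level_arg_eq[OF assms(1)], intro mult_mono) auto
  then have "w\<^sup>2 \<le> (B * (2 * S))\<^sup>2" using assms by (intro power_mono) auto
  also have "\<dots> = 4 * B\<^sup>2 * S\<^sup>2" by (simp add: power_mult_distrib)
  also have "\<dots> \<le> 4 * B\<^sup>2 * (3 * w)" using S2 by (intro mult_left_mono) auto
  finally have "w * w \<le> (12 * B\<^sup>2) * w" by (simp add: power2_eq_square)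
  then have "w \<le> 12 * B\<^sup>2" using False by (subst (asm) mult_le_cancel_right) auto
  then show ?thesis by (simp add: W_def)
qed

lemma drift_arg_nonneg: "0 \<le> w \<Longrightarrow> 0 \<le> drift_arg \<rho> \<delta> w"
  using scale_ge_1[of w] \<delta>\<rho> \<delta> by (simp add: drift_arg_def)

text \<open>The deviation is \<delta> (S - k) / k, where S and k both lie between 1 and 1 +
  O(\<rho>).\<close>

lemma drift_arg_diff:
  assumes "0 \<le> w" "w \<le> W + 1"
  shows "\<bar>drift_arg \<rho> \<delta> w - \<delta>\<bar> \<le> K * (\<rho> * L + K * \<rho>)" and "drift_arg \<rho> \<delta> w \<le> K + 1"
proof -
  define S where "S = sqrt (1 + \<delta> * \<rho> + \<rho> * w)"
  define k where "k = 1 + \<delta> * \<rho>"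
  have S: "1 \<le> S" "S \<le> 1 + \<rho> * L"
    using scale_ge_1[OF assms(1)] scale_le[OF assms] by (simp_all add: S_def)
  have k: "1 \<le> k" "k \<le> 1 + K * \<rho>" using \<delta>\<rho> by (simp_all add: k_def)
  have eq: "drift_arg \<rho> \<delta> w - \<delta> = \<delta> * ((S - k) / k)"
    unfolding drift_arg_def S_def[symmetric] unfolding k_def[symmetric] using k by (simp add: field_simps)
  have "\<bar>(S - k) / k\<bar> \<le> \<bar>S - k\<bar> / 1"
    using k by (subst abs_divide) (intro divide_left_mono; simp)
  also have "\<dots> \<le> \<rho> * L + K * \<rho>" using S k by (simp add: abs_le_iff)
  finally have "\<delta> * \<bar>(S - k) / k\<bar> \<le> K * (\<rho> * L + K * \<rho>)"
    using \<delta> by (intro mult_mono) auto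
  then show "\<bar>drift_arg \<rho> \<delta> w - \<delta>\<bar> \<le> K * (\<rho> * L + K * \<rho>)"
    unfolding eq using \<delta> by (simp add: abs_mult)
  have "drift_arg \<rho> \<delta> w \<le> \<delta> * S / 1"
    unfolding drift_arg_def S_def[symmetric] unfolding k_def[symmetric] using k S \<delta>
    by (intro divide_left_mono) auto
  also have "\<dots> \<le> K * (1 + \<rho> * L)" using \<delta> S by (simp, intro mult_mono) auto
  also have "\<dots> \<le> K + 1" using \<rho> by (simp add: algebra_simps)
  finally show "drift_arg \<rho> \<delta> w \<le> K + 1" .
qed

text \<open>Since 1 + \<delta> \<rho> \<le> 2, \<open>tail_arg\<close> is at least
  \<open>sqrt y\<close>; dropping the drift only increases the value. A constant \<open>y\<close>
  gives the cutoff, \<open>y\<close> of order 1 / \<rho> the vanishing tail.\<close>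

lemma tail_le:
  assumes "0 \<le> y" "y * (4 * \<rho>) \<le> w"
  shows "bm_cross (\<delta> * \<rho> * tail_arg \<rho> \<delta> w) (tail_arg \<rho> \<delta> w) \<le> bm_cross 0 (sqrt y)"
proof -
  have "0 \<le> w" using assms \<rho> by (meson mult_nonneg_nonneg order_trans less_imp_le zero_le_numeral)
  have "(1 + \<delta> * \<rho>)\<^sup>2 \<le> 2\<^sup>2" using \<delta>\<rho> by (intro power_mono) auto
  then have "y * (\<rho> * (1 + \<delta> * \<rho>)\<^sup>2) \<le> y * (\<rho> * 4)"
    using assms \<rho> by (intro mult_left_mono) auto
  also have "\<dots> \<le> w" using assms by (simp add: mult_ac)
  finally have "sqrt y \<le> tail_arg \<rho> \<delta> w"
    using \<rho> \<delta>\<rho> unfolding tail_arg_def by (subst real_sqrt_le_iff) (simp add: pos_le_divide_eq)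
  then have "bm_cross 0 (tail_arg \<rho> \<delta> w) \<le> bm_cross 0 (sqrt y)"
    by (simp add: bm_cross_le_iff)
  moreover have "0 \<le> tail_arg \<rho> \<delta> w"
    using \<open>0 \<le> w\<close> \<rho> by (simp add: tail_arg_def)
  ultimately show ?thesis
    using \<delta>\<rho> bm_cross_antimono_left[of 0 "\<delta> * \<rho> * tail_arg \<rho> \<delta> w" "tail_arg \<rho> \<delta> w"] by simp
qed

lemma tail_le_half_gap:
  assumes "V * \<rho> \<le> w"
  shows "bm_cross (\<delta> * \<rho> * tail_arg \<rho> \<delta> w) (tail_arg \<rho> \<delta> w) \<le> (1 - \<alpha>) / 2"
  using tail_le[of "v\<^sup>2" w] assms v by (simp add: V_def mult_ac)

text \<open>Intermediate values: at the left end the first term is at least (1 + \<alpha>) / 2 and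
  the tail at most (1 - \<alpha>) / 2; at \<open>W + 1\<close> the first term alone is at most
  \<alpha>.\<close>

lemma scaled_level_exists: "\<exists>w>V * \<rho>. scaled_prob \<rho> \<delta> w = \<alpha>"
proof -
  \<comment> \<open>The added 1 makes every level found lie strictly above the cutoff.\<close>
  define w1 where "w1 = (V + 1) * \<rho>"
  have w1: "V * \<rho> < w1" "0 < w1" "w1 \<le> W + 1" "w1 \<le> b\<^sub>0"
    using \<rho> V_pos by (auto simp: w1_def intro!: mult_pos_pos)
  have "(1 + \<alpha>) / 2 \<le> bm_cross (K + 1) (level_arg \<rho> \<delta> w1)"
    using level_arg_le[of w1] w1 K by (subst b\<^sub>0(2)[symmetric], subst bm_cross_le_iff) auto
  also have "\<dots> \<le> bm_cross (drift_arg \<rho> \<delta> w1) (level_arg \<rho> \<delta> w1)"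
    using drift_arg_diff(2)[of w1] level_arg_nonneg[of w1] w1 by (intro bm_cross_antimono_left) auto
  finally have ge: "\<alpha> \<le> scaled_prob \<rho> \<delta> w1"
    using tail_le_half_gap[of w1] w1 by (simp add: scaled_prob_def field_simps)
  have "0 \<le> W + 1" using W_pos by simp
  \<comment> \<open>Otherwise \<open>level_arg_le_imp_bounded\<close> would give
    \<open>W + 1 \<le> W\<close>.\<close>
  then have "B \<le> level_arg \<rho> \<delta> (W + 1)"
    using level_arg_le_imp_bounded[of "W + 1"] by force
  then have "bm_cross 0 (level_arg \<rho> \<delta> (W + 1)) \<le> \<alpha>"
    unfolding B(2)[symmetric] by (simp only: bm_cross_le_iff order_refl)
  moreover have "bm_cross (drift_arg \<rho> \<delta> (W + 1)) (level_arg \<rho> \<delta> (W + 1)) \<le> bm_cross 0 (level_arg \<rho> \<delta> (W + 1))"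
    using \<open>0 \<le> W + 1\<close> by (intro bm_cross_antimono_left drift_arg_nonneg level_arg_nonneg)
  ultimately have le: "scaled_prob \<rho> \<delta> (W + 1) \<le> \<alpha>"
    using bm_cross_nonneg[of "\<delta> * \<rho> * tail_arg \<rho> \<delta> (W + 1)" "tail_arg \<rho> \<delta> (W + 1)"]
    by (simp add: scaled_prob_def)
  have "(1 + \<delta> * \<rho>) * sqrt (1 + \<delta> * \<rho> + \<rho> * w) \<noteq> 0" if "w \<in> {w1..W + 1}" for w
    using scale_ge_1[of w] \<delta>\<rho> that w1 by simp
  moreover have "1 + \<delta> * \<rho> \<noteq> 0" "\<rho> * (1 + \<delta> * \<rho>)\<^sup>2 \<noteq> 0" using \<delta>\<rho> \<rho> by auto
  ultimately have "continuous_on {w1..W + 1} (\<lambda>w. scaled_prob \<rho> \<delta> w)"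
    unfolding scaled_prob_def drift_arg_def level_arg_def tail_arg_def
    by (intro continuous_intros) blast+
  from IVT2'[OF le ge w1(3) this] obtain w where "w1 \<le> w" "scaled_prob \<rho> \<delta> w = \<alpha>"
    by blast
  then show ?thesis
    using w1(1) by (intro exI[of _ w]) simp
qed

text \<open>First w is confined to a compact range; then b = \<open>level_arg\<close> is compared
  with x through their values at drift \<delta>, and w with b through the factor
  \<open>q\<close>.\<close>

lemma scaled_level_estimate:
  assumes w: "V * \<rho> < w" "scaled_prob \<rho> \<delta> w = \<alpha>" and x: "bm_cross \<delta> x = \<alpha>"
  shows "\<bar>w / x - 1\<bar> \<le> err \<rho>"
proof -
  define a where "a = drift_arg \<rho> \<delta> w"
  define b where "b = level_arg \<rho> \<delta> w"
  define \<epsilon> where "\<epsilon> = bm_cross (\<delta> * \<rho> * tail_arg \<rho> \<delta> w) (tail_arg \<rho> \<delta> w)"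
  have "0 < V * \<rho>" using V_pos \<rho> by simp
  then have w0: "0 \<le> w" using w by simp
  have eq: "bm_cross a b = \<alpha> + \<epsilon>" using w(2) by (simp add: scaled_prob_def a_def b_def \<epsilon>_def)
  have \<epsilon>: "0 \<le> \<epsilon>" "\<epsilon> \<le> (1 - \<alpha>) / 2"
    using tail_le_half_gap[of w] w by (auto simp: \<epsilon>_def bm_cross_nonneg)
  have b: "0 \<le> b" "b \<le> w" and a: "0 \<le> a"
    using level_arg_nonneg level_arg_le drift_arg_nonneg w0 by (auto simp: a_def b_def)
  have "bm_cross 0 B \<le> bm_cross a b" using eq \<epsilon> B by simp
  also have "\<dots> \<le> bm_cross 0 b" using a b by (intro bm_cross_antimono_left)
  finally have bB: "b \<le> B" by (simp add: bm_cross_le_iff)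
  then have wW: "w \<le> W + 1" using level_arg_le_imp_bounded[OF w0] by (simp add: b_def)
  note drift = drift_arg_diff[OF w0 wW, folded a_def]
  \<comment> \<open>The cutoff enters here: it bounds the tail, so the first term is at most (1 +
    \<alpha>) / 2 and b cannot fall below \<open>b\<^sub>0\<close>.\<close>
  have "bm_cross (K + 1) b \<le> bm_cross a b" using drift b by (intro bm_cross_antimono_left)
  also have "\<dots> \<le> bm_cross (K + 1) b\<^sub>0" using eq \<epsilon> b\<^sub>0 by (simp add: field_simps)
  finally have "b\<^sub>0 \<le> w" using b K by (simp add: bm_cross_le_iff)
  then have \<epsilon>_le: "\<epsilon> \<le> bm_cross 0 (sqrt (b\<^sub>0 / (4 * \<rho>)))"
    unfolding \<epsilon>_def using b\<^sub>0 \<rho> by (intro tail_le) auto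
  have "bm_cross \<delta> x < bm_cross \<delta> 0" using x \<alpha> by simp
  then have x_pos: "0 < x" using \<delta> by (simp only: bm_cross_less_iff)
  have "bm_cross K x \<le> bm_cross \<delta> x" using \<delta> x_pos by (intro bm_cross_antimono_left) auto
  then have x_ge: "x\<^sub>0 \<le> x"
    unfolding x x\<^sub>0(2)[symmetric] using K by (simp only: bm_cross_le_iff less_imp_le)
  have "bm_cross \<delta> x \<le> bm_cross 0 x" using \<delta> x_pos by (intro bm_cross_antimono_left) auto
  then have x_le: "x \<le> B"
    unfolding x B(2)[symmetric] by (simp only: bm_cross_le_iff order_refl)
  define E where "E = 2 * B * (K * (\<rho> * L + K * \<rho>)) + bm_cross 0 (sqrt (b\<^sub>0 / (4 * \<rho>)))"
  have "\<bar>bm_cross a b - bm_cross \<delta> b\<bar> \<le> 2 * b * \<bar>a - \<delta>\<bar>"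
    using a b \<delta> by (intro bm_cross_Lipschitz_left) auto
  also have "\<dots> \<le> 2 * B * (K * (\<rho> * L + K * \<rho>))"
    using drift b bB by (intro mult_mono) auto
  \<comment> \<open>The value at b misses \<alpha> by the tail \<epsilon> and by the change of drift
    from a to \<delta>.\<close>
  finally have "\<bar>bm_cross \<delta> b - bm_cross \<delta> x\<bar> \<le> E"
    using eq x \<epsilon> \<epsilon>_le unfolding E_def by linarith
  moreover have "2 * std_normal_density (K + B) * \<bar>b - x\<bar> \<le> \<bar>bm_cross \<delta> b - bm_cross \<delta> x\<bar>"
    using \<delta> b bB x_pos x_le by (intro bm_cross_expansion_right) auto
  ultimately have bx: "\<bar>b - x\<bar> \<le> E / (2 * std_normal_density (K + B))"
    using normal_density_pos[of 1 0 "K + B"] by (subst pos_le_divide_eq) (auto simp: mult_ac)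
  define q where "q = (1 + \<delta> * \<rho>) * sqrt (1 + \<delta> * \<rho> + \<rho> * w)"
  have "1 * 1 \<le> q" unfolding q_def
    using scale_ge_1[OF w0] \<delta>\<rho> by (intro mult_mono) auto
  moreover have "q \<le> (1 + K * \<rho>) * (1 + \<rho> * L)" unfolding q_def
    using scale_ge_1[OF w0] scale_le[OF w0 wW] \<delta>\<rho> by (intro mult_mono) auto
  moreover have "w = b * q" using level_arg_eq[OF w0] by (simp add: b_def q_def)
  ultimately have "\<bar>w - b\<bar> \<le> B * ((1 + K * \<rho>) * (1 + \<rho> * L) - 1)"
  proof -
    assume q: "1 * 1 \<le> q" "q \<le> (1 + K * \<rho>) * (1 + \<rho> * L)" and "w = b * q"
    then have "\<bar>w - b\<bar> = b * (q - 1)" using b by (simp add: algebra_simps)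
    also have "\<dots> \<le> B * ((1 + K * \<rho>) * (1 + \<rho> * L) - 1)"
      using q b bB by (intro mult_mono) auto
    finally show ?thesis .
  qed
  with bx have num: "\<bar>w - x\<bar> \<le> B * ((1 + K * \<rho>) * (1 + \<rho> * L) - 1) + E / (2 * std_normal_density (K + B))"
    by linarith
  have "\<bar>w / x - 1\<bar> = \<bar>w - x\<bar> / x"
    using x_pos by (simp add: field_simps)
  also have "\<dots> \<le> \<bar>w - x\<bar> / x\<^sub>0"
    using x_ge x\<^sub>0 by (intro divide_left_mono) auto
  also have "\<dots> \<le> err \<rho>"
    unfolding err_def E_def[symmetric] using num x\<^sub>0 by (intro divide_right_mono) auto
  finally show ?thesis .
qed

lemma level_equation_pos: "bm_cross \<delta> x = \<alpha> \<Longrightarrow> 0 < x"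
  using bm_cross_less_iff[OF \<delta>(1), of x 0] \<alpha> by simp

end

end

section \<open>Return to the original variables\<close>

text \<open>The constant \<open>U\<close> separates the levels of order sqrt t from the bounded
  ones. Existence above \<open>U\<close> keeps the asymptotics from being vacuous, and
  \<open>u\<close> and \<open>x\<close> are arbitrary selections of solutions.\<close>

theorem theorem6p7:
  fixes M D \<alpha> K :: real
  assumes "M > 0" and "D > 0" and "0 < \<alpha>" and "\<alpha> < 1" and "K > 0"
  shows "(\<forall>\<delta>\<in>{0..<K}. \<exists>x. solves_x_eq \<alpha> \<delta> x) \<and>
    (\<exists>U. (\<forall>\<^sub>F t in at_top. \<forall>\<delta>\<in>{0..<K}.
             \<exists>v>U. is_heur_level M D \<alpha> t (c_near M D t \<delta>) v) \<and>
         (\<forall>(u :: real \<Rightarrow> real \<Rightarrow> real) (x :: real \<Rightarrow> real).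
            (\<forall>\<^sub>F t in at_top. \<forall>\<delta>\<in>{0..<K}.
               is_heur_level M D \<alpha> t (c_near M D t \<delta>) (u t (c_near M D t \<delta>)) \<and>
               u t (c_near M D t \<delta>) > U) \<longrightarrow>
            (\<forall>\<delta>\<in>{0..<K}. solves_x_eq \<alpha> \<delta> (x \<delta>)) \<longrightarrow>
            (\<exists>r. uniform_limit {0..<K} r (\<lambda>_. 0) at_top \<and>
               (\<forall>\<^sub>F t in at_top. \<forall>\<delta>\<in>{0..<K}.
                  u t (c_near M D t \<delta>) =
                    D / M powr (3/2) * x \<delta> * sqrt t * (1 + r t \<delta>)))))"
    (is "?ex \<and> ?asymp")
proof
  show ?ex
  proof
    fix \<delta> assume "\<delta> \<in> {0..<K}"
    then obtain x where "bm_cross \<delta> x = \<alpha>"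
      using bm_cross_solution_exists[of \<delta> \<alpha>] assms by auto
    then show "\<exists>x. solves_x_eq \<alpha> \<delta> x" by (auto simp: solves_x_eq_iff)
  qed
next
  \<comment> \<open>Antitonicity in the drift dictates the drifts: 0 for upper bounds on levels and
    for the tail, \<open>K\<close> and \<open>K + 1\<close> for lower bounds.\<close>
  obtain B where B: "0 < B" "bm_cross 0 B = \<alpha>"
    using bm_cross_solution_exists[of 0 \<alpha>] assms by auto
  obtain b\<^sub>0 where b0: "0 < b\<^sub>0" "bm_cross (K + 1) b\<^sub>0 = (1 + \<alpha>) / 2"
    using bm_cross_solution_exists[of "K + 1" "(1 + \<alpha>) / 2"] assms by auto
  obtain x\<^sub>0 where x0: "0 < x\<^sub>0" "bm_cross K x\<^sub>0 = \<alpha>"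
    using bm_cross_solution_exists[of K \<alpha>] assms by auto
  obtain v where v: "0 < v" "bm_cross 0 v = (1 - \<alpha>) / 2"
    using bm_cross_solution_exists[of 0 "(1 - \<alpha>) / 2"] assms by auto
  interpret scaled_levels \<alpha> K B b\<^sub>0 x\<^sub>0 v
    using assms B b0 x0 v by unfold_locales
  define \<rho> where "\<rho> t = D / sqrt M * t powr (- 1 / 2)" for t
  define A where "A = D / M powr (3/2)"
  have A: "0 < A" using assms by (simp add: A_def)
  have \<rho>_sqrt: "\<rho> t * sqrt t = D / sqrt M" if "0 < t" for t
    using that by (simp add: \<rho>_def powr_minus_divide powr_half_sqrt)
  have "filterlim \<rho> (at_right 0) at_top"
    unfolding \<rho>_def[abs_def] using assms by real_asymp
  then have lim: "((\<lambda>t. err (\<rho> t)) \<longlongrightarrow> 0) at_top"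
    and ev: "\<forall>\<^sub>F t in at_top. admissible (\<rho> t)"
    using filterlim_compose[OF err_tendsto] eventually_admissible by (auto simp: filterlim_iff)
  from eventually_conj[OF eventually_gt_at_top ev]
  have adm: "\<forall>\<^sub>F t in at_top. 0 < t \<and> admissible (\<rho> t)" .
  \<comment> \<open>The cutoff w > V \<rho> multiplied by A sqrt t; as \<rho> sqrt t is constant, it
    does not depend on t.\<close>
  let ?U = "A * V * (D / sqrt M)"
  show ?asymp
  proof (intro exI[of _ ?U] conjI allI impI)
    show "\<forall>\<^sub>F t in at_top. \<forall>\<delta>\<in>{0..<K}. \<exists>v>?U. is_heur_level M D \<alpha> t (c_near M D t \<delta>) v"
      using adm
    proof (eventually_elim, intro ballI)
      fix t \<delta> assume t: "0 < t \<and> admissible (\<rho> t)" and \<delta>: "\<delta> \<in> {0..<K}"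
      then obtain w where w: "V * \<rho> t < w" "scaled_prob (\<rho> t) \<delta> w = \<alpha>"
        using scaled_level_exists[of "\<rho> t" \<delta>] by auto
      have "0 < V * \<rho> t" using t V_pos by (simp add: admissible_def)
      then have w0: "0 < w" using w by simp
      have "A * V * (\<rho> t * sqrt t) < A * w * sqrt t"
        using w(1) t A by simp
      then have "?U < A * w * sqrt t" using \<rho>_sqrt t by simp
      moreover have "is_heur_level M D \<alpha> t (c_near M D t \<delta>) (A * w * sqrt t)"
        using heur_prob_rescale[of M D t \<delta> w] assms t \<delta> w w0 A
        by (simp add: is_heur_level_def A_def \<rho>_def)
      ultimately show "\<exists>v>?U. is_heur_level M D \<alpha> t (c_near M D t \<delta>) v" by blast
    qed
  next
    fix u :: "real \<Rightarrow> real \<Rightarrow> real" and x :: "real \<Rightarrow> real"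
    assume u: "\<forall>\<^sub>F t in at_top. \<forall>\<delta>\<in>{0..<K}.
               is_heur_level M D \<alpha> t (c_near M D t \<delta>) (u t (c_near M D t \<delta>)) \<and>
               u t (c_near M D t \<delta>) > ?U"
      and x: "\<forall>\<delta>\<in>{0..<K}. solves_x_eq \<alpha> \<delta> (x \<delta>)"
    \<comment> \<open>The relative error w / x - 1, forced by the asymptotic formula.\<close>
    define r where "r t \<delta> = u t (c_near M D t \<delta>) / (A * sqrt t) / x \<delta> - 1" for t \<delta>
    have main: "\<forall>\<^sub>F t in at_top. \<forall>\<delta>\<in>{0..<K}. \<bar>r t \<delta>\<bar> \<le> err (\<rho> t) \<and>
        u t (c_near M D t \<delta>) = A * x \<delta> * sqrt t * (1 + r t \<delta>)"
      using adm u
    proof (eventually_elim, intro ballI)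
      fix t \<delta> assume t: "0 < t \<and> admissible (\<rho> t)" and \<delta>: "\<delta> \<in> {0..<K}"
        and u: "\<forall>\<delta>\<in>{0..<K}. is_heur_level M D \<alpha> t (c_near M D t \<delta>) (u t (c_near M D t \<delta>)) \<and>
               u t (c_near M D t \<delta>) > ?U"
      define w where "w = u t (c_near M D t \<delta>) / (A * sqrt t)"
      have u_eq: "u t (c_near M D t \<delta>) = A * w * sqrt t" using A t by (simp add: w_def)
      have level: "is_heur_level M D \<alpha> t (c_near M D t \<delta>) (A * w * sqrt t)" "?U < A * w * sqrt t"
        using u \<delta> unfolding u_eq[symmetric] by blast+
      have w0: "0 < w" using level(1) A t by (simp add: is_heur_level_def zero_less_mult_iff)
      have "(A * sqrt t) * (V * \<rho> t) < (A * sqrt t) * w"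
        using level(2) \<rho>_sqrt[of t] t by (simp add: mult_ac)
      then have "V * \<rho> t < w" using A t by (subst (asm) mult_less_cancel_left_pos) auto
      moreover have "scaled_prob (\<rho> t) \<delta> w = \<alpha>"
        using heur_prob_rescale[of M D t \<delta> w] assms t \<delta> w0 level(1)
        by (simp add: is_heur_level_def A_def \<rho>_def)
      moreover have x\<delta>: "bm_cross \<delta> (x \<delta>) = \<alpha>" using x \<delta> by (simp add: solves_x_eq_iff)
      ultimately have "\<bar>w / x \<delta> - 1\<bar> \<le> err (\<rho> t)"
        using t \<delta> by (intro scaled_level_estimate) auto
      moreover have "0 < x \<delta>" using level_equation_pos[OF _ _ _ x\<delta>] t \<delta> by auto
      ultimately show "\<bar>r t \<delta>\<bar> \<le> err (\<rho> t) \<and> u t (c_near M D t \<delta>) = A * x \<delta> * sqrt t * (1 + r t \<delta>)"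
        using A t by (simp add: r_def w_def[symmetric] u_eq)
    qed
    \<comment> \<open>The bound \<open>err (\<rho> t)\<close> is free of \<delta>, so convergence is
      uniform.\<close>
    have "uniform_limit {0..<K} r (\<lambda>_. 0) at_top"
    proof (rule uniform_limitI)
      fix e :: real assume "0 < e"
      from order_tendstoD(2)[OF lim this] main
      show "\<forall>\<^sub>F t in at_top. \<forall>\<delta>\<in>{0..<K}. dist (r t \<delta>) 0 < e"
        by eventually_elim force
    qed
    moreover have "\<forall>\<^sub>F t in at_top. \<forall>\<delta>\<in>{0..<K}. u t (c_near M D t \<delta>) =
        D / M powr (3/2) * x \<delta> * sqrt t * (1 + r t \<delta>)"
      using main by eventually_elim (simp add: A_def)
    ultimately show "\<exists>r. uniform_limit {0..<K} r (\<lambda>_. 0) at_top \<and>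
        (\<forall>\<^sub>F t in at_top. \<forall>\<delta>\<in>{0..<K}. u t (c_near M D t \<delta>) =
          D / M powr (3/2) * x \<delta> * sqrt t * (1 + r t \<delta>))" by blast
  qed
qed

end
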